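(* For every 2-connected partial $k$-tree $G$, $\mathrm{lct}(G)\leq k-1$.
   Context: All graphs are finite and simple. A $k$-tree is defined recursively: the complete graph on $k$ vertices is a $k$-tree, and any graph obtained from a $k$-tree by adding a new vertex adjacent to exactly the vertices of an existing $k$-clique is a $k$-tree. A partial $k$-tree is a subgraph of a $k$-tree (equivalently, a graph of treewidth at most $k$). $\mathrm{lct}(G)$ is the minimum cardinality of a set of vertices that intersects every longest cycle (cycle of maximum length) of $G$. *)

theory Defs
  imports Main
begin

text \<open>A finite simple graph: finite vertex set V, edges are 2-element subsets of V.\<close>
definition simple_graph :: "'a set \<Rightarrow> 'a set set \<Rightarrow> bool" where
  "simple_graph V E \<longleftrightarrow> finite V \<and>
     (\<forall>e\<in>E. \<exists>u v. e = {u, v} \<and> u \<noteq> v \<and> u \<in> V \<and> v \<in> V)"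

text \<open>All edges of the complete graph on a vertex set.\<close>
definition all_edges :: "'a set \<Rightarrow> 'a set set" where
  "all_edges V = {{u, v} | u v. u \<in> V \<and> v \<in> V \<and> u \<noteq> v}"

definition is_clique :: "'a set \<Rightarrow> 'a set set \<Rightarrow> 'a set \<Rightarrow> bool" where
  "is_clique V E C \<longleftrightarrow> C \<subseteq> V \<and> (\<forall>u\<in>C. \<forall>v\<in>C. u \<noteq> v \<longrightarrow> {u, v} \<in> E)"

text \<open>k-trees, defined recursively as in the paper.\<close>
inductive ktree :: "nat \<Rightarrow> 'a set \<Rightarrow> 'a set set \<Rightarrow> bool" for k :: nat where
  base: "finite V \<Longrightarrow> card V = k \<Longrightarrow> ktree k V (all_edges V)"
| step: "ktree k V E \<Longrightarrow> is_clique V E C \<Longrightarrow> card C = k \<Longrightarrow> v \<notin> V \<Longrightarrow>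
         ktree k (insert v V) (E \<union> {{v, c} | c. c \<in> C})"

text \<open>A partial k-tree: a simple graph isomorphic to a subgraph of some k-tree.
  The host k-tree is taken on natural-number vertices (so that the host may have
  more vertices than the vertex type of G provides).\<close>
definition partial_ktree :: "nat \<Rightarrow> 'a set \<Rightarrow> 'a set set \<Rightarrow> bool" where
  "partial_ktree k V E \<longleftrightarrow> simple_graph V E \<and>
     (\<exists>(V' :: nat set) E' f. ktree k V' E' \<and> inj_on f V \<and> f ` V \<subseteq> V' \<and>
        (\<forall>u\<in>V. \<forall>v\<in>V. {u, v} \<in> E \<longrightarrow> {f u, f v} \<in> E'))"

definition connected :: "'a set \<Rightarrow> 'a set set \<Rightarrow> bool" where
  "connected V E \<longleftrightarrow> (\<forall>u\<in>V. \<forall>v\<in>V.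
     (u, v) \<in> {(x, y). x \<in> V \<and> y \<in> V \<and> {x, y} \<in> E}\<^sup>*)"

text \<open>2-connected: at least 3 vertices, connected, and no cut vertex
  (removing any vertex, together with its incident edges, leaves a connected graph).\<close>
definition two_connected :: "'a set \<Rightarrow> 'a set set \<Rightarrow> bool" where
  "two_connected V E \<longleftrightarrow> card V \<ge> 3 \<and> connected V E \<and>
     (\<forall>v\<in>V. connected (V - {v}) {e \<in> E. v \<notin> e})"

text \<open>A cycle, given as the cyclic list of its (distinct) vertices.\<close>
definition is_cycle :: "'a set \<Rightarrow> 'a set set \<Rightarrow> 'a list \<Rightarrow> bool" where
  "is_cycle V E c \<longleftrightarrow> distinct c \<and> length c \<ge> 3 \<and> set c \<subseteq> V \<and>
     (\<forall>i < length c. {c ! i, c ! ((i + 1) mod length c)} \<in> E)"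

definition is_longest_cycle :: "'a set \<Rightarrow> 'a set set \<Rightarrow> 'a list \<Rightarrow> bool" where
  "is_longest_cycle V E c \<longleftrightarrow> is_cycle V E c \<and>
     (\<forall>d. is_cycle V E d \<longrightarrow> length d \<le> length c)"

text \<open>lct(G): minimum cardinality of a vertex set meeting every longest cycle.\<close>
definition lct :: "'a set \<Rightarrow> 'a set set \<Rightarrow> nat" where
  "lct V E = (LEAST n. \<exists>S. S \<subseteq> V \<and> card S = n \<and>
     (\<forall>c. is_longest_cycle V E c \<longrightarrow> set c \<inter> S \<noteq> {}))"

end

theory Submission
  imports Defs
begin

text \<open>In a 2-connected graph any two longest cycles share at least two vertices. It therefore suffices
  to find, for a family of cycles of a \<open>k\<close>-tree that pairwise share two vertices, a transversal with
  at most \<open>k - 1\<close> vertices. Suppose there is none. Then for every bag (of \<open>k + 1\<close> vertices) and every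
  pair of its vertices, some cycle of the family meets the bag within this pair. Comparing two such
  cycles, some cycle meets the bag in at most one vertex, and so runs in a single branch at the bag.
  These branches orient the tree of bags consistently, which is impossible in a finite tree.\<close>

section \<open>Cycles as closed walks\<close>

text \<open>The passage to an arbitrary family is forced: longest cycles of \<open>G\<close> need
  not be longest in the host \<open>k\<close>-tree, and of their maximality only the pairwise
  intersection in two vertices is carried over. The bound \<open>k - 1\<close> is what remains of a
  bag of \<open>k + 1\<close> vertices when a pair is removed. Sharing two vertices matters because
  the cycles compared, although they use different branches, may still meet in one vertex of the
  bag. Branches are never formed as vertex sets: a vertex is coloured by a bag vertex that its
  branch misses. This colour is constant along edges outside the bag, and an arc between two bag
  vertices can have neither of them as a colour. Ages of vertices replace the tree: at the bag of
  \<open>v\<close>, a colour other than \<open>v\<close> forces a younger vertex than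
  \<open>v\<close>.\<close>

lemma is_cycle_iff:
  "is_cycle V E c \<longleftrightarrow> distinct c \<and> 3 \<le> length c \<and> set c \<subseteq> V \<and>
     successively (\<lambda>u v. {u, v} \<in> E) (c @ [hd c])"
proof (cases "c = []")
  case False
  \<comment> \<open>The appended head stands for the index that wraps around modulo
    \<open>length c\<close>.\<close>
  have "(c @ [hd c]) ! i = c ! i \<and> (c @ [hd c]) ! Suc i = c ! ((i + 1) mod length c)"
    if "i < length c" for i
    using that False by (cases "Suc i = length c") (auto simp: nth_append hd_conv_nth)
  then show ?thesis
    by (auto simp: is_cycle_def successively_conv_nth)
qed (auto simp: is_cycle_def)

lemma is_cycle_rotate:
  assumes "is_cycle V E (xs @ ys)"
  shows "is_cycle V E (ys @ xs)"
proof -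
  have "successively (\<lambda>u v. {u, v} \<in> E) ((ys @ xs) @ [hd (ys @ xs)])"
    using assms unfolding is_cycle_iff
    by (cases xs; cases ys)
      (auto simp: successively_append_iff successively_Cons hd_append split: if_splits)
  then show ?thesis
    using assms unfolding is_cycle_iff by auto
qed

lemma is_cycle_start_at:
  assumes "is_cycle V E c" "x \<in> set c"
  obtains xs where "is_cycle V E (x # xs)" "set (x # xs) = set c" "length (x # xs) = length c"
proof -
  obtain as bs where c: "c = as @ x # bs"
    using assms(2) by (meson split_list)
  then have "is_cycle V E (x # bs @ as)"
    using is_cycle_rotate[of V E as "x # bs"] assms(1) by simp
  then show ?thesis
    using c by (intro that[of "bs @ as"]) auto
qed

lemma is_cycle_arcs:
  assumes "is_cycle V E c" "x \<in> set c" "y \<in> set c" "x \<noteq> y"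
  obtains xs ys where "distinct (x # xs @ y # ys)" "set (x # xs @ y # ys) = set c"
    "length (x # xs @ y # ys) = length c"
    "successively (\<lambda>u v. {u, v} \<in> E) (x # xs @ [y])"
    "successively (\<lambda>u v. {u, v} \<in> E) (y # ys @ [x])"
proof -
  obtain zs where zs: "is_cycle V E (x # zs)" "set (x # zs) = set c" "length (x # zs) = length c"
    using is_cycle_start_at[OF assms(1,2)] .
  then have "y \<in> set zs"
    using assms(3,4) by (metis set_ConsD)
  then obtain xs ys where zs': "zs = xs @ y # ys"
    by (meson split_list)
  have walks: "successively (\<lambda>u v. {u, v} \<in> E) ((x # xs) @ y # ys @ [x])"
    using zs(1) zs' by (simp add: is_cycle_iff)
  show ?thesis
  proof (rule that)
    show "distinct (x # xs @ y # ys)"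
      using zs(1) zs' by (simp add: is_cycle_iff)
    show "successively (\<lambda>u v. {u, v} \<in> E) (x # xs @ [y])"
      "successively (\<lambda>u v. {u, v} \<in> E) (y # ys @ [x])"
      using walks successively_append_iff[of _ "x # xs" "y # ys @ [x]"]
        successively_append_iff[of _ "x # xs" "[y]"] by simp_all
  qed (use zs zs' in simp_all)
qed

section \<open>Colourings that are constant along the edges of a cycle\<close>

lemma successively_imp_const:
  assumes "successively R xs"
    and "\<And>u v. u \<in> set xs \<Longrightarrow> v \<in> set xs \<Longrightarrow> R u v \<Longrightarrow> f u = f v"
    and "u \<in> set xs" "v \<in> set xs"
  shows "f u = f v"
proof -
  have "\<forall>u\<in>set xs. f u = f (hd xs)"
    using assms(1,2)
  proof (induction xs)
    case (Cons x xs)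
    show ?case
    proof (cases "xs = []")
      case False
      then have *: "R x (hd xs)" "successively R xs"
        using Cons.prems(1) by (simp_all add: successively_Cons)
      then have "f x = f (hd xs)"
        using Cons.prems(2)[of x "hd xs"] False by simp
      moreover have "\<forall>u\<in>set xs. f u = f (hd xs)"
        using Cons.IH[OF *(2)] Cons.prems(2) by (meson list.set_intros(2))
      ultimately show ?thesis
        by simp
    qed simp
  qed simp
  then show ?thesis
    using assms(3,4) by metis
qed

text \<open>A cycle minus at most one vertex is still traversed by a single walk. The vertex
  \<open>p\<close> may lie off the cycle, which covers cycles that avoid a bag altogether.\<close>

lemma cycle_minus_vertex_const:
  assumes "is_cycle V E c"
    and "\<And>u v. u \<in> set c - {p} \<Longrightarrow> v \<in> set c - {p} \<Longrightarrow> {u, v} \<in> E \<Longrightarrow> f u = f v"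
    and "u \<in> set c - {p}" "v \<in> set c - {p}"
  shows "f u = f v"
proof (cases "p \<in> set c")
  case True
  obtain xs where xs: "is_cycle V E (p # xs)" "set (p # xs) = set c"
    using is_cycle_start_at[OF assms(1) True] .
  then have *: "successively (\<lambda>u v. {u, v} \<in> E) xs" "set xs = set c - {p}"
    by (auto simp: is_cycle_iff successively_append_iff successively_Cons)
  show ?thesis
    using successively_imp_const[OF *(1), of f u v] assms(2-4) *(2) by blast
next
  case False
  have *: "successively (\<lambda>u v. {u, v} \<in> E) c"
    using assms(1) by (auto simp: is_cycle_iff successively_append_iff)
  show ?thesis
    using successively_imp_const[OF *, of f u v] assms(2-4) False by blast
qed

text \<open>Each nonempty arc has one end next to \<open>x\<close> and one next to \<open>y\<close>,
  so its colour also occurs on a neighbour of either. When colours name non-neighbours, this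
  excludes \<open>x\<close> and \<open>y\<close> as colours.\<close>

lemma cycle_minus_two_vertices_colours:
  assumes "is_cycle V E c" "x \<in> set c" "y \<in> set c" "x \<noteq> y"
    and "\<And>u v. u \<in> set c - {x, y} \<Longrightarrow> v \<in> set c - {x, y} \<Longrightarrow> {u, v} \<in> E \<Longrightarrow> f u = f v"
  shows "\<exists>a b. f ` (set c - {x, y}) = {a, b}"
    and "\<forall>u\<in>set c - {x, y}. \<forall>z\<in>{x, y}. \<exists>w\<in>set c - {x, y}. {w, z} \<in> E \<and> f w = f u"
proof -
  obtain xs ys where arcs: "distinct (x # xs @ y # ys)" "set (x # xs @ y # ys) = set c"
    "length (x # xs @ y # ys) = length c"
    "successively (\<lambda>u v. {u, v} \<in> E) (x # xs @ [y])"
    "successively (\<lambda>u v. {u, v} \<in> E) (y # ys @ [x])"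
    using is_cycle_arcs[OF assms(1-4)] .
  have sets: "set c - {x, y} = set xs \<union> set ys"
    using arcs(1,2) by auto
  have "length c \<ge> 3"
    using assms(1) by (simp add: is_cycle_def)
  then have ne: "xs \<noteq> [] \<or> ys \<noteq> []"
    using arcs(3) by auto
  have "successively (\<lambda>u v. {u, v} \<in> E) xs"
    using arcs(4) by (simp add: successively_append_iff successively_Cons split: if_splits)
  then have cx: "f u = f v" if "u \<in> set xs" "v \<in> set xs" for u v
    using successively_imp_const[of "\<lambda>u v. {u, v} \<in> E" xs f u v] that sets assms(5) by blast
  have "successively (\<lambda>u v. {u, v} \<in> E) ys"
    using arcs(5) by (simp add: successively_append_iff successively_Cons split: if_splits)
  then have cy: "f u = f v" if "u \<in> set ys" "v \<in> set ys" for u v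
    using successively_imp_const[of "\<lambda>u v. {u, v} \<in> E" ys f u v] that sets assms(5) by blast
  \<comment> \<open>An empty arc borrows the colour of the other one, which is nonempty because a
    cycle has a third vertex; so \<open>{a, b}\<close> is exactly the image.\<close>
  define a where "a = (if xs = [] then f (hd ys) else f (hd xs))"
  define b where "b = (if ys = [] then f (hd xs) else f (hd ys))"
  have "f u \<in> {a, b}" if "u \<in> set xs \<union> set ys" for u
  proof (cases "u \<in> set xs")
    case True
    then have "xs \<noteq> []"
      by auto
    then show ?thesis
      using cx[OF True, of "hd xs"] by (simp add: a_def)
  next
    case False
    then have u: "u \<in> set ys"
      using that by simp
    then have "ys \<noteq> []"
      by auto
    then show ?thesis
      using cy[OF u, of "hd ys"] by (simp add: b_def)
  qed
  then have "f ` (set xs \<union> set ys) \<subseteq> {a, b}"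
    by blast
  moreover have "{a, b} \<subseteq> f ` (set xs \<union> set ys)"
    using ne unfolding a_def b_def by auto
  ultimately show "\<exists>a b. f ` (set c - {x, y}) = {a, b}"
    using sets by (metis subset_antisym)
  have "\<exists>w\<in>set c - {x, y}. {w, z} \<in> E \<and> f w = f u"
    if "u \<in> set c - {x, y}" "z \<in> {x, y}" for u z
  proof (cases "u \<in> set xs")
    case True
    then have "{hd xs, x} \<in> E" "{last xs, y} \<in> E" "hd xs \<in> set xs" "last xs \<in> set xs"
      using length_pos_if_in_set[OF True] arcs(4)
      by (auto simp: successively_append_iff successively_Cons insert_commute hd_append)
    then show ?thesis
      using that True sets cx by blast
  next
    case False
    then have u: "u \<in> set ys"
      using that sets by auto
    then have "{hd ys, y} \<in> E" "{last ys, x} \<in> E" "hd ys \<in> set ys" "last ys \<in> set ys"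
      using length_pos_if_in_set[OF u] arcs(5)
      by (auto simp: successively_append_iff successively_Cons insert_commute hd_append)
    then show ?thesis
      using that u sets cy by blast
  qed
  then show "\<forall>u\<in>set c - {x, y}. \<forall>z\<in>{x, y}. \<exists>w\<in>set c - {x, y}. {w, z} \<in> E \<and> f w = f u"
    by (intro ballI)
qed

lemma cycle_has_neighbour:
  assumes "is_cycle V E c" "x \<in> set c"
  obtains y where "y \<in> set c" "y \<noteq> x" "{y, x} \<in> E"
proof -
  obtain xs where xs: "is_cycle V E (x # xs)" "set (x # xs) = set c" "length (x # xs) = length c"
    using is_cycle_start_at[OF assms] .
  then have "xs \<noteq> []"
    by (auto simp: is_cycle_iff)
  then have "{hd xs, x} \<in> E" "hd xs \<in> set xs" "x \<notin> set xs"
    using xs(1) by (auto simp: is_cycle_iff successively_append_iff successively_Cons insert_commute)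
  then show ?thesis
    using xs(2) that by auto
qed


section \<open>Two longest cycles of a 2-connected graph\<close>

definition walk :: "'a set \<Rightarrow> 'a set set \<Rightarrow> 'a list \<Rightarrow> bool" where
  "walk V E p \<longleftrightarrow> p \<noteq> [] \<and> set p \<subseteq> V \<and> successively (\<lambda>u v. {u, v} \<in> E) p"

lemma walk_suffix:
  assumes "walk V E (p @ x # q)"
  shows "walk V E (x # q)"
  using assms by (auto simp: walk_def successively_append_iff)

lemma walk_join:
  assumes "walk V E (p @ x # q)" "walk V E (x # r)"
  shows "walk V E (p @ x # r)"
  using assms by (auto simp: walk_def successively_append_iff)

lemma walk_Cons:
  assumes "walk V E p" "x \<in> V" "{x, hd p} \<in> E"
  shows "walk V E (x # p)"
  using assms by (auto simp: walk_def successively_Cons)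

lemma connected_imp_walk:
  assumes "connected V E" "u \<in> V" "v \<in> V"
  obtains p where "walk V E p" "hd p = u" "last p = v"
proof -
  have "(u, v) \<in> {(x, y). x \<in> V \<and> y \<in> V \<and> {x, y} \<in> E}\<^sup>*"
    using assms by (auto simp: connected_def)
  then have "\<exists>p. walk V E p \<and> hd p = u \<and> last p = v"
  proof (induction rule: converse_rtrancl_induct)
    case base
    show ?case
      using assms(3) by (intro exI[of _ "[v]"]) (auto simp: walk_def)
  next
    case (step y z)
    then obtain p where "walk V E p" "hd p = z" "last p = v"
      by auto
    then show ?case
      using step.hyps(1) by (intro exI[of _ "y # p"]) (auto simp: walk_def successively_Cons)
  qed
  then show ?thesis
    using that by auto
qed

lemma two_connected_walk_avoiding:
  assumes "two_connected V E" "x \<in> V" "u \<in> V - {x}" "v \<in> V - {x}"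
  obtains p where "walk V E p" "hd p = u" "last p = v" "x \<notin> set p"
proof -
  have "connected (V - {x}) {e \<in> E. x \<notin> e}"
    using assms by (auto simp: two_connected_def)
  from connected_imp_walk[OF this assms(3,4)]
  obtain p where p: "walk (V - {x}) {e \<in> E. x \<notin> e} p" "hd p = u" "last p = v" .
  then have "successively (\<lambda>u v. {u, v} \<in> {e \<in> E. x \<notin> e}) p"
    by (simp only: walk_def)
  then have "successively (\<lambda>u v. {u, v} \<in> E) p"
    by (rule successively_mono) simp
  then have "walk V E p" "x \<notin> set p"
    using p(1) by (auto simp: walk_def)
  then show ?thesis
    using that p by auto
qed

text \<open>Menger's theorem for two paths: the pair of walks from \<open>z\<close> and its neighbour \<open>y\<close> is rerouted
  along a walk from \<open>a\<close> that avoids \<open>y\<close>, cut where it first meets the pair or \<open>B\<close>.\<close>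
lemma two_disjoint_walks:
  assumes G: "two_connected V E"
    and B: "B \<subseteq> V" "b \<in> B" "b' \<in> B" "b \<noteq> b'"
    and v: "v \<in> V" and a: "a \<in> V" "a \<noteq> v"
  obtains p q where "walk V E p" "walk V E q" "hd p = v" "hd q = a"
    "last p \<in> B" "last q \<in> B" "set p \<inter> set q = {}"
proof -
  have avoid: "\<exists>r. walk V E r \<and> hd r = a \<and> last r \<in> B \<and> x \<notin> set r"
    if "x \<in> V" "a \<in> V" "a \<noteq> x" for x a
  proof -
    obtain b'' where b'': "b'' \<in> B" "b'' \<noteq> x"
      using B(2-4) by (cases "b = x") auto
    then have "a \<in> V - {x}" "b'' \<in> V - {x}"
      using that B(1) by auto
    from two_connected_walk_avoiding[OF G that(1) this] show ?thesis
      using b'' by metis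
  qed
  have "(v, b) \<in> {(x, y). x \<in> V \<and> y \<in> V \<and> {x, y} \<in> E}\<^sup>*"
    using G B v by (auto simp: two_connected_def connected_def)
  \<comment> \<open>The second start \<open>a\<close> is quantified because the induction step uses
    the hypothesis for \<open>a = y\<close>, the vertex just before \<open>z\<close>.\<close>
  then have "\<forall>a\<in>V. a \<noteq> v \<longrightarrow> (\<exists>p q. walk V E p \<and> walk V E q \<and> hd p = v \<and> hd q = a \<and>
    last p \<in> B \<and> last q \<in> B \<and> set p \<inter> set q = {})"
  proof (induction rule: converse_rtrancl_induct)
    case base
    show ?case
    proof (intro ballI impI)
      fix a assume a: "a \<in> V" "a \<noteq> b"
      obtain r where "walk V E r" "hd r = a" "last r \<in> B" "b \<notin> set r"
        using avoid[of b a] a B by blast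
      then show "\<exists>p q. walk V E p \<and> walk V E q \<and> hd p = b \<and> hd q = a \<and>
        last p \<in> B \<and> last q \<in> B \<and> set p \<inter> set q = {}"
        using B by (intro exI[of _ "[b]"] exI[of _ r]) (auto simp: walk_def)
    qed
  next
    case (step y z)
    show ?case
    proof (intro ballI impI)
      fix a assume a: "a \<in> V" "a \<noteq> y"
      let ?goal = "\<exists>p q. walk V E p \<and> walk V E q \<and> hd p = y \<and> hd q = a \<and>
        last p \<in> B \<and> last q \<in> B \<and> set p \<inter> set q = {}"
      have yz: "y \<in> V" "z \<in> V" "{y, z} \<in> E"
        using step.hyps(1) by auto
      show ?goal
      proof (cases "y = z")
        case True
        then show ?thesis
          using step.IH a by blast
      next
        case False
        then obtain p q0 where pq0: "walk V E p" "walk V E q0" "hd p = z" "hd q0 = y"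
          "last p \<in> B" "last q0 \<in> B" "set p \<inter> set q0 = {}"
          using step.IH yz by blast
        then have "y \<in> set q0"
          using hd_in_set[of q0] by (auto simp: walk_def)
        \<comment> \<open>Cutting at the last visit of \<open>y\<close> keeps \<open>y\<close> off
          the rest, so that \<open>y # p\<close> is disjoint from every proper tail of
          \<open>q\<close>.\<close>
        then obtain q1 q' where q0: "q0 = q1 @ y # q'" "y \<notin> set q'"
          by (meson split_list_last)
        define q where "q = y # q'"
        have pq: "walk V E p" "walk V E q" "hd p = z" "hd q = y"
          "last p \<in> B" "last q \<in> B" "set p \<inter> set q = {}"
          using pq0 q0 walk_suffix[of V E q1 y q'] by (auto simp: q_def)
        have ne: "p \<noteq> []" "q \<noteq> []"
          using pq by (auto simp: walk_def)
        have yp: "walk V E (y # p)" "last (y # p) \<in> B"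
          using pq yz ne by (auto intro!: walk_Cons)
        obtain r where r: "walk V E r" "hd r = a" "last r \<in> B" "y \<notin> set r"
          using avoid yz(1) a by blast
        have "last r \<in> set r"
          using r(1) by (auto simp: walk_def)
        then have "\<exists>x\<in>set r. x \<in> set p \<union> set q \<union> B"
          using r(3) by auto
        then obtain r1 x r2 where x: "r = r1 @ x # r2" "x \<in> set p \<union> set q \<union> B"
          "\<forall>u\<in>set r1. u \<notin> set p \<union> set q \<union> B"
          using split_list_first_prop[of r "\<lambda>x. x \<in> set p \<union> set q \<union> B"] by blast
        have "x \<noteq> y"
          using r(4) x(1) by auto
        have hd: "hd (r1 @ x # s) = a" for s
          using r(2) x(1) by (cases r1) auto
        consider "x \<in> set p" | "x \<in> set q" | "x \<in> B" "x \<notin> set p" "x \<notin> set q"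
          using x(2) by auto
        then show ?thesis
        proof cases
          case 1
          then obtain p1 p2 where p: "p = p1 @ x # p2"
            by (meson split_list)
          have "walk V E (r1 @ x # p2)"
            using walk_join[of V E r1 x r2 p2] walk_suffix[of V E p1 x p2] r(1) x(1) pq(1) p by auto
          then show ?thesis
            using pq p x(3) hd by (intro exI[of _ q] exI[of _ "r1 @ x # p2"]) auto
        next
          \<comment> \<open>The tail of \<open>q\<close> now serves \<open>a\<close>, so
            \<open>y\<close> switches to the edge to \<open>z\<close> followed by
            \<open>p\<close>.\<close>
          case 2
          then obtain q1 q2 where q': "q' = q1 @ x # q2"
            using \<open>x \<noteq> y\<close> split_list[of x q'] by (auto simp: q_def)
          then have q: "q = (y # q1) @ x # q2"
            by (simp add: q_def)
          have "walk V E (r1 @ x # q2)"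
            using walk_join[of V E r1 x r2 q2] walk_suffix[of V E "y # q1" x q2] r(1) x(1) pq(2) q by auto
          moreover have "y \<notin> set q2"
            using q0(2) q' by simp
          moreover have "y \<notin> set r1"
            using r(4) x(1) by auto
          ultimately show ?thesis
            using pq yp q x(3) hd \<open>x \<noteq> y\<close> by (intro exI[of _ "y # p"] exI[of _ "r1 @ x # q2"]) auto
        next
          case 3
          have "walk V E (r1 @ [x])"
            using walk_join[of V E r1 x r2 "[]"] r(1) x(1) by (auto simp: walk_def)
          then show ?thesis
            using pq x(3) hd 3 by (intro exI[of _ q] exI[of _ "r1 @ [x]"]) auto
        qed
      qed
    qed
  qed
  then show ?thesis
    using a that by blast
qed

text \<open>A shortest walk from \<open>A\<close> to \<open>B\<close> inside \<open>set p\<close>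
  works: a further vertex of \<open>A\<close> or \<open>B\<close>, or a repetition, would allow a
  shortcut. Its ends may differ from those of \<open>p\<close>.\<close>

lemma walk_trim:
  assumes "walk V E p" "hd p \<in> A" "last p \<in> B"
  obtains q where "walk V E q" "distinct q" "set q \<subseteq> set p"
    "hd q \<in> A" "last q \<in> B" "set q \<inter> A = {hd q}" "set q \<inter> B = {last q}"
proof -
  define Q where "Q q \<longleftrightarrow> walk V E q \<and> set q \<subseteq> set p \<and> hd q \<in> A \<and> last q \<in> B" for q
  have "Q p"
    using assms by (simp add: Q_def)
  then obtain q where q: "Q q" and min: "\<And>r. Q r \<Longrightarrow> length q \<le> length r"
    using ex_has_least_nat[of Q p length] by blast
  have ne: "q \<noteq> []"
    using q by (auto simp: Q_def walk_def)
  have "x = hd q" if "x \<in> set q" "x \<in> A" for x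
  proof -
    obtain q1 q2 where split: "q = q1 @ x # q2"
      using \<open>x \<in> set q\<close> by (meson split_list)
    have "Q (x # q2)"
      using q that split walk_suffix[of V E q1 x q2] by (auto simp: Q_def)
    from min[OF this] show ?thesis
      using split by simp
  qed
  then have A: "set q \<inter> A = {hd q}"
    using q ne by (auto simp: Q_def)
  have "x = last q" if "x \<in> set q" "x \<in> B" for x
  proof -
    obtain q1 q2 where split: "q = q1 @ x # q2"
      using \<open>x \<in> set q\<close> by (meson split_list)
    have "Q (q1 @ [x])"
      using q that split by (auto simp: Q_def walk_def successively_append_iff hd_append split: if_splits)
    from min[OF this] show ?thesis
      using split by simp
  qed
  then have B: "set q \<inter> B = {last q}"
    using q ne by (auto simp: Q_def)
  have "distinct q"
  proof (rule ccontr)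
    assume "\<not> distinct q"
    then obtain xs y ys zs where split: "q = xs @ [y] @ ys @ [y] @ zs"
      using not_distinct_decomp by blast
    then have "walk V E (xs @ y # zs)"
      using q walk_join[of V E xs y "ys @ [y] @ zs" zs] walk_suffix[of V E "xs @ [y] @ ys" y zs]
      by (simp add: Q_def)
    then have "Q (xs @ y # zs)"
      using q split by (auto simp: Q_def hd_append split: if_splits)
    from min[OF this] show False
      using split by simp
  qed
  then show ?thesis
    using q A B that by (auto simp: Q_def)
qed

section \<open>Splicing two cycles along disjoint connecting paths\<close>

text \<open>The two arcs have \<open>length c - 2\<close> inner vertices in all, so the longer one
  has at least half of them; it is reversed if it runs from \<open>y\<close> to
  \<open>x\<close>.\<close>

lemma is_cycle_long_arc:
  assumes "is_cycle V E c" "x \<in> set c" "y \<in> set c" "x \<noteq> y"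
  obtains xs where "distinct xs" "x \<notin> set xs" "y \<notin> set xs" "set xs \<subseteq> set c"
    "successively (\<lambda>u v. {u, v} \<in> E) (x # xs @ [y])" "length c \<le> 2 * length xs + 2"
proof -
  obtain xs ys where arcs: "distinct (x # xs @ y # ys)" "set (x # xs @ y # ys) = set c"
    "length (x # xs @ y # ys) = length c"
    "successively (\<lambda>u v. {u, v} \<in> E) (x # xs @ [y])"
    "successively (\<lambda>u v. {u, v} \<in> E) (y # ys @ [x])"
    using is_cycle_arcs[OF assms] .
  show ?thesis
  proof (cases "length ys \<le> length xs")
    case True
    show ?thesis
      by (rule that[of xs]) (use arcs True in auto)
  next
    case False
    have "successively (\<lambda>u v. {u, v} \<in> E) (rev (y # ys @ [x]))"
      unfolding successively_rev using arcs(5) by (simp add: insert_commute)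
    then show ?thesis
      by (intro that[of "rev ys"]) (use arcs(1-3) False in auto)
  qed
qed

text \<open>The closed walk that follows the longer arc of \<open>c\<close> between the two starting points and the
  longer arc of \<open>d\<close> between the two end points. If \<open>c\<close> and \<open>d\<close> meet in one vertex \<open>x\<close>, this is
  applied with \<open>p = [x]\<close>.\<close>
lemma splice_cycles:
  assumes c: "is_cycle V E c" and d: "is_cycle V E d"
    and p: "walk V E p" "distinct p" "set p \<inter> set c = {hd p}" "set p \<inter> set d = {last p}"
    and q: "walk V E q" "distinct q" "set q \<inter> set c = {hd q}" "set q \<inter> set d = {last q}"
    and disj: "set p \<inter> set q = {}" and common: "set c \<inter> set d \<subseteq> set p"
    and len: "3 \<le> length p + length q"
  obtains e where "is_cycle V E e" "length c + length d + 2 \<le> 2 * length e"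
proof -
  have ne: "p \<noteq> []" "q \<noteq> []"
    using p q by (auto simp: walk_def)
  have ends: "hd p \<in> set p" "last p \<in> set p" "hd q \<in> set q" "last q \<in> set q"
    using ne by auto
  then have neq: "hd p \<noteq> hd q" "last q \<noteq> last p"
    using disj by (metis IntI empty_iff)+
  obtain xs where xs: "distinct xs" "hd p \<notin> set xs" "hd q \<notin> set xs" "set xs \<subseteq> set c"
    "successively (\<lambda>u v. {u, v} \<in> E) (hd p # xs @ [hd q])" "length c \<le> 2 * length xs + 2"
    using is_cycle_long_arc[OF c _ _ neq(1)] p(3) q(3) by blast
  obtain zs where zs: "distinct zs" "last q \<notin> set zs" "last p \<notin> set zs" "set zs \<subseteq> set d"
    "successively (\<lambda>u v. {u, v} \<in> E) (last q # zs @ [last p])" "length d \<le> 2 * length zs + 2"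
    using is_cycle_long_arc[OF d _ _ neq(2)] p(4) q(4) by blast
  \<comment> \<open>\<open>rev p\<close> leads from \<open>d\<close> to \<open>c\<close>,
    \<open>xs\<close> follows \<open>c\<close>, \<open>q\<close> returns to \<open>d\<close>, and
    \<open>zs\<close> closes up along \<open>d\<close>.\<close>
  define e where "e = rev p @ xs @ q @ zs"
  have disjoint: "A \<inter> X = {}" if "A \<inter> B = {h}" "X \<subseteq> B" "h \<notin> X" for A B X :: "'a set" and h
  proof -
    have "A \<inter> X \<subseteq> {h}"
      unfolding that(1)[symmetric] using that(2) by blast
    then show ?thesis
      using that(3) by blast
  qed
  have "set p \<inter> set xs = {}" "set q \<inter> set xs = {}"
    using disjoint[OF p(3) xs(4,2)] disjoint[OF q(3) xs(4,3)] .
  moreover have "set p \<inter> set zs = {}" "set q \<inter> set zs = {}"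
    using disjoint[OF p(4) zs(4,3)] disjoint[OF q(4) zs(4,2)] .
  moreover from calculation have "set xs \<inter> set zs = {}"
    using xs(4) zs(4) common by blast
  ultimately have "distinct e"
    using disj p(2) q(2) xs(1) zs(1) unfolding e_def by auto
  moreover have "set e \<subseteq> V"
    using xs(4) zs(4) p(1) q(1) c d unfolding e_def is_cycle_iff walk_def by auto
  moreover have "successively (\<lambda>u v. {u, v} \<in> E) (e @ [hd e])"
  proof -
    have "successively (\<lambda>u v. {u, v} \<in> E) (rev p)"
      unfolding successively_rev using p(1) by (simp add: walk_def insert_commute)
    moreover have "hd (rev p @ s) = last p" for s
      using ne by (simp add: hd_append hd_rev)
    ultimately show ?thesis
      using xs(5) zs(5) q(1) ne unfolding e_def walk_def
      by (cases "xs = []"; cases "zs = []")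
        (simp_all add: successively_append_iff successively_Cons last_rev hd_append)
  qed
  moreover have "length e = length xs + length zs + (length p + length q)"
    by (simp add: e_def)
  moreover have "3 \<le> length e"
    using calculation len by simp
  \<comment> \<open>Twice the length is at least
    \<open>(length c - 2) + (length d - 2) + 2 * 3\<close>.\<close>
  ultimately show ?thesis
    using xs(6) zs(6) len by (intro that[of e]) (auto simp: is_cycle_iff)
qed

lemma is_cycle_obtain_two:
  assumes "is_cycle V E c"
  obtains x y where "x \<in> set c" "y \<in> set c" "x \<noteq> y"
proof -
  have "distinct c" "0 < length c" "1 < length c"
    using assms by (auto simp: is_cycle_def)
  then have "c ! 0 \<in> set c" "c ! 1 \<in> set c" "c ! 0 \<noteq> c ! 1"
    using nth_eq_iff_index_eq[of c 0 1] nth_mem[of 0 c] nth_mem[of 1 c] by simp_all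
  then show ?thesis
    using that by blast
qed

text \<open>Otherwise two disjoint paths join the cycles, one of them trivial if there is a common
  vertex. Both cycles have the same length, and splicing yields a cycle with at least one vertex
  more.\<close>

lemma longest_cycles_share_two:
  assumes G: "two_connected V E"
    and c: "is_longest_cycle V E c" and d: "is_longest_cycle V E d"
  shows "\<exists>x y. x \<noteq> y \<and> {x, y} \<subseteq> set c \<inter> set d"
proof (rule ccontr)
  assume neg: "\<not> ?thesis"
  have cyc: "is_cycle V E c" "is_cycle V E d"
    and max: "\<And>e. is_cycle V E e \<Longrightarrow> length e \<le> length c"
    using c d by (simp_all add: is_longest_cycle_def)
  have len: "length d = length c"
    using c d cyc by (simp add: is_longest_cycle_def le_antisym)
  have V: "set c \<subseteq> V" "set d \<subseteq> V"
    using cyc by (auto simp: is_cycle_def)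
  obtain c1 c2 where c12: "c1 \<in> set c" "c2 \<in> set c" "c1 \<noteq> c2"
    using is_cycle_obtain_two[OF cyc(1)] .
  obtain d1 d2 where d12: "d1 \<in> set d" "d2 \<in> set d" "d1 \<noteq> d2"
    using is_cycle_obtain_two[OF cyc(2)] .
  have splice: False
    if pq: "walk V E p" "distinct p" "set p \<inter> set c = {hd p}" "set p \<inter> set d = {last p}"
      "walk V E q" "distinct q" "set q \<inter> set c = {hd q}" "set q \<inter> set d = {last q}"
      "set p \<inter> set q = {}" "set c \<inter> set d \<subseteq> set p" "hd q \<noteq> last q" for p q
  proof -
    have "p \<noteq> []" "q \<noteq> []"
      using pq(1,5) by (auto simp: walk_def)
    moreover obtain y ys where "q = y # ys"
      using \<open>q \<noteq> []\<close> by (cases q) auto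
    moreover from this have "ys \<noteq> []"
      using pq(11) by auto
    ultimately have "0 < length p" "0 < length ys" "length q = Suc (length ys)"
      by simp_all
    then have "3 \<le> length p + length q"
      by linarith
    then obtain e where "is_cycle V E e" "length c + length d + 2 \<le> 2 * length e"
      using splice_cycles[OF cyc pq(1-10)] by blast
    then show False
      using max[of e] len by simp
  qed
  show False
  proof (cases "set c \<inter> set d = {}")
    case True
    have "c1 \<in> V" "c2 \<in> V"
      using c12 V(1) by auto
    from two_disjoint_walks[OF G V(2) d12 this c12(3)[symmetric]]
    obtain p0 q0 where pq0: "walk V E p0" "walk V E q0" "hd p0 = c1" "hd q0 = c2"
      "last p0 \<in> set d" "last q0 \<in> set d" "set p0 \<inter> set q0 = {}" .
    have hd0: "hd p0 \<in> set c" "hd q0 \<in> set c"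
      using pq0(3,4) c12 by simp_all
    obtain p where p: "walk V E p" "distinct p" "set p \<subseteq> set p0" "hd p \<in> set c" "last p \<in> set d"
      "set p \<inter> set c = {hd p}" "set p \<inter> set d = {last p}"
      using walk_trim[OF pq0(1) hd0(1) pq0(5)] .
    obtain q where q: "walk V E q" "distinct q" "set q \<subseteq> set q0" "hd q \<in> set c" "last q \<in> set d"
      "set q \<inter> set c = {hd q}" "set q \<inter> set d = {last q}"
      using walk_trim[OF pq0(2) hd0(2) pq0(6)] .
    have "set p \<inter> set q = {}"
      using p(3) q(3) pq0(7) by blast
    moreover have "hd q \<noteq> last q"
      using True q(4,5) by auto
    ultimately show False
      using splice[OF p(1,2,6,7) q(1,2,6,7)] True by simp
  next
    case False
    then obtain x where x: "x \<in> set c" "x \<in> set d"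
      by auto
    have one: "set c \<inter> set d = {x}"
      using neg x by auto
    obtain c' where c': "c' \<in> set c - {x}"
      using c12 by blast
    obtain d' where d': "d' \<in> set d - {x}"
      using d12 by blast
    have "x \<in> V" "c' \<in> V - {x}" "d' \<in> V - {x}"
      using c' d' V x by auto
    from two_connected_walk_avoiding[OF G this]
    obtain q0 where q0: "walk V E q0" "hd q0 = c'" "last q0 = d'" "x \<notin> set q0" .
    have ends0: "hd q0 \<in> set c - {x}" "last q0 \<in> set d - {x}"
      using q0 c' d' by simp_all
    obtain q where q: "walk V E q" "distinct q" "set q \<subseteq> set q0"
      "hd q \<in> set c - {x}" "last q \<in> set d - {x}"
      "set q \<inter> (set c - {x}) = {hd q}" "set q \<inter> (set d - {x}) = {last q}"
      using walk_trim[OF q0(1) ends0] .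
    have "x \<notin> set q"
      using q(3) q0(4) by auto
    then have "set q \<inter> set c = set q \<inter> (set c - {x})" "set q \<inter> set d = set q \<inter> (set d - {x})"
      by auto
    then have qcd: "set q \<inter> set c = {hd q}" "set q \<inter> set d = {last q}"
      using q(6,7) by simp_all
    have qneq: "hd q \<noteq> last q"
    proof
      assume "hd q = last q"
      then have "hd q \<in> set c \<inter> set d - {x}"
        using q(4,5) by simp
      then show False
        using one by simp
    qed
    have wx: "walk V E [x]"
      using \<open>x \<in> V\<close> by (simp add: walk_def)
    have px: "distinct [x]" "set [x] \<inter> set c = {hd [x]}" "set [x] \<inter> set d = {last [x]}"
      "set [x] \<inter> set q = {}" "set c \<inter> set d \<subseteq> set [x]"
      using x \<open>x \<notin> set q\<close> one by simp_all
    show False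
      by (rule splice[OF wx px(1-3) q(1,2) qcd px(4,5) qneq])
  qed
qed


section \<open>Cycles in k-trees\<close>

text \<open>Every vertex \<open>v\<close> outside the initial clique (the vertices of rank 0) comes with the bag \<open>K v\<close> formed
  by \<open>v\<close> and the clique to which it was attached. The remaining vertices fall into branches at this
  bag, and a branch sees at most \<open>k\<close> of the \<open>k + 1\<close> vertices of the bag: \<open>m v u\<close> is a vertex of the
  bag that the branch of \<open>u\<close> misses. All branches that contain older vertices miss \<open>v\<close>.\<close>
definition bags :: "nat \<Rightarrow> 'a set \<Rightarrow> 'a set set \<Rightarrow> ('a \<Rightarrow> nat) \<Rightarrow> ('a \<Rightarrow> 'a set) \<Rightarrow> ('a \<Rightarrow> 'a \<Rightarrow> 'a) \<Rightarrow> bool"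
  where
  "bags k V E r K m \<longleftrightarrow> card {v \<in> V. r v = 0} = k \<and>
     (\<forall>v\<in>V. 0 < r v \<longrightarrow>
       v \<in> K v \<and> K v \<subseteq> V \<and> card (K v) = Suc k \<and>
       (\<forall>u\<in>K v. u \<noteq> v \<longrightarrow> r u < r v) \<and>
       (\<forall>u\<in>V - K v. m v u \<in> K v \<and> {u, m v u} \<notin> E \<and> (r u \<le> r v \<longrightarrow> m v u = v)) \<and>
       (\<forall>u\<in>V - K v. \<forall>w\<in>V - K v. {u, w} \<in> E \<longrightarrow> m v u = m v w))"

lemma ktree_finite:
  assumes "ktree k V E"
  shows "finite V"
  using assms by induction auto

lemma ktree_edges_subset:
  assumes "ktree k V E" "e \<in> E"
  shows "e \<subseteq> V"
  using assms by (induction arbitrary: e) (auto simp: all_edges_def is_clique_def)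

text \<open>At an old bag, the vertices of the clique \<open>C\<close> outside the bag share one
  colour, which the new vertex takes over. This colour is not in \<open>C\<close>, because it is not
  adjacent to those vertices. If \<open>C\<close> lies inside the bag, \<open>k < k + 1\<close>
  yields a bag vertex outside \<open>C\<close> to serve as the colour.\<close>

lemma bags_insert:
  assumes T: "ktree k V E" and C: "is_clique V E C" "card C = k" and w: "w \<notin> V"
    and b: "bags k V E r K m"
  shows "\<exists>r K m. bags k (insert w V) (E \<union> {{w, c} |c. c \<in> C}) r K m"
proof -
  have fin: "finite V"
    using ktree_finite[OF T] .
  have CV: "C \<subseteq> V"
    using C(1) by (simp add: is_clique_def)
  then have "finite C"
    using fin finite_subset by auto
  have wE: "{w, x} \<notin> E" for x
    using ktree_edges_subset[OF T] w by auto
  have "\<exists>s. s \<in> K v \<and> s \<notin> C \<and> (\<forall>c\<in>C - K v. m v c = s)" if "v \<in> V" "0 < r v" for v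
  proof (cases "C \<subseteq> K v")
    case True
    have "card C < card (K v)"
      using b that C(2) by (simp add: bags_def)
    then have "\<not> K v \<subseteq> C"
      using card_mono[OF \<open>finite C\<close>, of "K v"] by auto
    then show ?thesis
      using True by auto
  next
    case False
    then obtain c where c: "c \<in> C" "c \<notin> K v"
      by auto
    have K: "\<And>u. u \<in> V - K v \<Longrightarrow> m v u \<in> K v \<and> {u, m v u} \<notin> E"
      "\<And>u w. u \<in> V - K v \<Longrightarrow> w \<in> V - K v \<Longrightarrow> {u, w} \<in> E \<Longrightarrow> m v u = m v w"
      using b that unfolding bags_def by blast+
    have adj: "{x, y} \<in> E" if "x \<in> C" "y \<in> C" "x \<noteq> y" for x y
      using C(1) that by (simp add: is_clique_def)
    have "c \<in> V - K v"
      using c CV by auto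
    then have "m v c \<in> K v" "{c, m v c} \<notin> E"
      using K(1) by auto
    then have "m v c \<notin> C"
      using adj[of c "m v c"] c by metis
    moreover have "m v c' = m v c" if "c' \<in> C - K v" for c'
    proof (cases "c' = c")
      case False
      then show ?thesis
        using K(2)[of c' c] adj[of c' c] that c CV by blast
    qed simp
    ultimately show ?thesis
      using \<open>m v c \<in> K v\<close> by blast
  qed
  then obtain s where s: "\<And>v. v \<in> V \<Longrightarrow> 0 < r v \<Longrightarrow>
      s v \<in> K v \<and> s v \<notin> C \<and> (\<forall>c\<in>C - K v. m v c = s v)"
    by metis
  obtain N where N: "\<forall>v\<in>V. r v < N"
    using finite_nat_set_iff_bounded[of "r ` V"] fin by auto
  \<comment> \<open>The new rank exceeds all old ones, so at an old bag the clause that forces the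
    colour \<open>v\<close> does not apply to \<open>w\<close>.\<close>
  define r' where "r' = r(w := Suc N)"
  define K' where "K' = K(w := insert w C)"
  \<comment> \<open>At the new bag the single colour \<open>w\<close> suffices: all neighbours of
    \<open>w\<close> lie in \<open>C\<close>, hence in the bag.\<close>
  define m' where "m' v u = (if v = w then w else if u = w then s v else m v u)" for v u
  have rank: "r' u = r u" "r u < Suc N" if "u \<in> V" for u
    using that w N by (auto simp: r'_def less_Suc_eq)
  have "{v \<in> insert w V. r' v = 0} = {v \<in> V. r v = 0}"
    using w by (auto simp: r'_def)
  then have card: "card {v \<in> insert w V. r' v = 0} = k"
    using b by (simp add: bags_def)
  define good where "good v \<longleftrightarrow> v \<in> K' v \<and> K' v \<subseteq> insert w V \<and> card (K' v) = Suc k \<and>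
     (\<forall>u\<in>K' v. u \<noteq> v \<longrightarrow> r' u < r' v) \<and>
     (\<forall>u\<in>insert w V - K' v. m' v u \<in> K' v \<and> {u, m' v u} \<notin> E \<union> {{w, c} |c. c \<in> C} \<and>
        (r' u \<le> r' v \<longrightarrow> m' v u = v)) \<and>
     (\<forall>u\<in>insert w V - K' v. \<forall>x\<in>insert w V - K' v.
        {u, x} \<in> E \<union> {{w, c} |c. c \<in> C} \<longrightarrow> m' v u = m' v x)" for v
  have old: "good v"
    if v: "v \<in> V" "0 < r v" for v
  proof -
    have K: "v \<in> K v" "K v \<subseteq> V" "card (K v) = Suc k" "\<And>u. u \<in> K v \<Longrightarrow> u \<noteq> v \<Longrightarrow> r u < r v"
      "\<And>u. u \<in> V - K v \<Longrightarrow> m v u \<in> K v \<and> {u, m v u} \<notin> E \<and> (r u \<le> r v \<longrightarrow> m v u = v)"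
      "\<And>u w. u \<in> V - K v \<Longrightarrow> w \<in> V - K v \<Longrightarrow> {u, w} \<in> E \<Longrightarrow> m v u = m v w"
      using b v unfolding bags_def by blast+
    have vw: "v \<noteq> w"
      using v w by auto
    have K': "K' v = K v"
      using vw by (simp add: K'_def)
    have m': "m' v u = m v u" if "u \<in> V" for u
      using that w vw by (auto simp: m'_def)
    have m'w: "m' v w = s v"
      using vw by (simp add: m'_def)
    have ranks: "r' u < r' v" if "u \<in> K v" "u \<noteq> v" for u
      using K(2,4) that rank v by (metis subsetD)
    have missed: "m' v u \<in> K v \<and> {u, m' v u} \<notin> E \<union> {{w, c} |c. c \<in> C} \<and>
        (r' u \<le> r' v \<longrightarrow> m' v u = v)" if "u \<in> insert w V - K v" for u
    proof (cases "u = w")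
      case True
      have "\<not> r' w \<le> r' v"
        using rank[OF v(1)] by (simp add: r'_def)
      then show ?thesis
        using s[OF v] wE True m'w by (auto simp: doubleton_eq_iff)
    next
      case False
      then have u: "u \<in> V - K v"
        using that by auto
      then have "m v u \<in> K v" "m v u \<noteq> w"
        using K(2,5) w by auto
      then show ?thesis
        using False K(5)[OF u] u rank(1)[of u] rank(1)[OF v(1)] m'[of u]
        by (auto simp: doubleton_eq_iff)
    qed
    have edges: "m' v u = m' v x"
      if "u \<in> insert w V - K v" "x \<in> insert w V - K v" "{u, x} \<in> E \<union> {{w, c} |c. c \<in> C}" for u x
    proof -
      have new: "m' v w = m' v c" if "c \<in> C" "c \<notin> K v" for c
        using that s[OF v] m'w m'[of c] CV by auto
      consider "{u, x} \<in> E" | c where "c \<in> C" "{u, x} = {w, c}"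
        using \<open>{u, x} \<in> E \<union> {{w, c} |c. c \<in> C}\<close> by blast
      then show ?thesis
      proof cases
        case 1
        then have "u \<noteq> w" "x \<noteq> w"
          using wE[of x] wE[of u] by (auto simp: insert_commute)
        then show ?thesis
          using K(6)[of u x] 1 that m' by auto
      next
        case 2
        then show ?thesis
          using new[of c] that by (auto simp: doubleton_eq_iff)
      qed
    qed
    show ?thesis
      unfolding good_def K'
    proof (intro conjI ballI impI)
      show "K v \<subseteq> insert w V"
        using K(2) by (rule subset_insertI2)
    next
      fix u x assume "u \<in> insert w V - K v" "x \<in> insert w V - K v"
        "{u, x} \<in> E \<union> {{w, c} |c. c \<in> C}"
      then show "m' v u = m' v x"
        by (rule edges)
    qed (use K(1,3) ranks missed in simp_all)
  qed
  have new: "good w"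
  proof -
    have "card (insert w C) = Suc k"
      using \<open>finite C\<close> C(2) CV w by (subst card_insert_disjoint) auto
    moreover have "r' u < r' w" if "u \<in> C" for u
      using rank[of u] that CV by (auto simp: r'_def)
    moreover have "{u, w} \<notin> E \<union> {{w, c} |c. c \<in> C}" if "u \<notin> insert w C" for u
      using that wE[of u] by (auto simp: doubleton_eq_iff insert_commute)
    ultimately show ?thesis
      using CV by (auto simp: good_def K'_def m'_def)
  qed
  have "bags k (insert w V) (E \<union> {{w, c} |c. c \<in> C}) r' K' m'"
    unfolding bags_def good_def[symmetric]
  proof (intro conjI card ballI impI)
    fix v assume "v \<in> insert w V" "0 < r' v"
    then show "good v"
      using old[of v] new rank(1)[of v] by (cases "v = w") auto
  qed
  then show ?thesis
    by blast
qed

lemma ktree_has_bags: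
  assumes "ktree k V E"
  shows "\<exists>r K m. bags k V E r K m"
  using assms
proof induction
  case (base V)
  then show ?case
    by (intro exI[of _ "\<lambda>_. 0"]) (simp add: bags_def)
next
  case (step V E C v)
  then obtain r K m where "bags k V E r K m"
    by blast
  from bags_insert[OF step.hyps this] show ?case .
qed

text \<open>Two cycles suffice. If a cycle meets \<open>K\<close> exactly in \<open>x\<close> and \<open>y\<close>, its two arcs run in branches missing
  \<open>a\<close> and \<open>b\<close>, say, both different from \<open>x\<close> and \<open>y\<close>. A cycle that meets \<open>K\<close> exactly in \<open>a\<close> and \<open>b\<close>
  does not enter these branches, so it is disjoint from the first one. If \<open>a = b\<close>, a cycle that meets
  \<open>K\<close> exactly in \<open>a\<close> and \<open>x\<close> shares at most \<open>x\<close> with the first one.\<close>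
lemma cycle_meets_bag_at_most_once:
  assumes cyc: "\<And>C. C \<in> L \<Longrightarrow> is_cycle V E C"
    and share: "\<And>C D. C \<in> L \<Longrightarrow> D \<in> L \<Longrightarrow> \<exists>x y. x \<noteq> y \<and> {x, y} \<subseteq> set C \<inter> set D"
    and miss: "\<And>S. S \<subseteq> V \<Longrightarrow> card S \<le> k - 1 \<Longrightarrow> \<exists>C\<in>L. set C \<inter> S = {}"
    and K: "finite K" "K \<subseteq> V" "card K = Suc k"
    and mK: "\<And>u. u \<in> V - K \<Longrightarrow> m u \<in> K \<and> {u, m u} \<notin> E"
    and m_edge: "\<And>u w. u \<in> V - K \<Longrightarrow> w \<in> V - K \<Longrightarrow> {u, w} \<in> E \<Longrightarrow> m u = m w"
  obtains C p where "C \<in> L" "set C \<inter> K \<subseteq> {p}"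
proof (rule ccontr)
  assume "\<not> thesis"
  then have no: "\<And>C p. C \<in> L \<Longrightarrow> \<not> set C \<inter> K \<subseteq> {p}"
    using that by blast
  have pair: "\<exists>C\<in>L. set C \<inter> K = {x, y}" if "x \<in> K" "y \<in> K" "x \<noteq> y" for x y
  proof -
    have "card (K - {x, y}) = k - 1"
      using K that by (simp add: card_Diff_subset)
    then obtain C where C: "C \<in> L" "set C \<inter> (K - {x, y}) = {}"
      using miss[of "K - {x, y}"] K(2) by auto
    then have "set C \<inter> K = {x, y}"
      using no[OF C(1), of x] no[OF C(1), of y] by blast
    then show ?thesis
      using C(1) by blast
  qed
  have colours: "\<exists>a b. m ` (set C - K) = {a, b} \<and> {a, b} \<subseteq> K \<and> {a, b} \<inter> {x, y} = {}"
    if C: "C \<in> L" and xy: "set C \<inter> K = {x, y}" "x \<noteq> y" for C x y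
  proof -
    have V: "set C \<subseteq> V"
      using cyc[OF C] by (simp add: is_cycle_def)
    have eq: "set C - {x, y} = set C - K"
      using xy by blast
    have const: "m u = m w" if "u \<in> set C - {x, y}" "w \<in> set C - {x, y}" "{u, w} \<in> E" for u w
      using that m_edge V eq by blast
    have "x \<in> set C" "y \<in> set C"
      using xy(1) by auto
    note arcs = cycle_minus_two_vertices_colours[OF cyc[OF C] this xy(2), where f = m, OF const]
    obtain a b where ab: "m ` (set C - {x, y}) = {a, b}"
      using arcs(1) by blast
    have "m u \<notin> {x, y}" if u: "u \<in> set C - K" for u
    proof
      assume "m u \<in> {x, y}"
      then have "\<exists>w\<in>set C - K. {w, m u} \<in> E \<and> m w = m u"
        using arcs(2) u unfolding eq by blast
      then obtain w where w: "w \<in> set C - K" "{w, m u} \<in> E" "m w = m u"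
        by blast
      then show False
        using mK[of w] V by auto
    qed
    then have "m ` (set C - K) \<inter> {x, y} = {}"
      by blast
    moreover have "m ` (set C - K) \<subseteq> K"
      using mK V by blast
    ultimately show ?thesis
      using ab unfolding eq by metis
  qed
  have "K \<noteq> {}" "\<not> (\<exists>p. K \<subseteq> {p})"
  proof -
    show "K \<noteq> {}"
      using K by auto
    \<comment> \<open>This disposes of \<open>k = 0\<close>, where the bag is a single vertex and
      contains no pair.\<close>
    obtain C where "C \<in> L"
      using miss[of "{}"] by auto
    then show "\<not> (\<exists>p. K \<subseteq> {p})"
      using no by blast
  qed
  then obtain x y where xy: "x \<in> K" "y \<in> K" "x \<noteq> y"
    by blast
  obtain C where C: "C \<in> L" "set C \<inter> K = {x, y}"
    using pair[OF xy] by blast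
  obtain a b where ab: "m ` (set C - K) = {a, b}" "{a, b} \<subseteq> K" "{a, b} \<inter> {x, y} = {}"
    using colours[OF C xy(3)] by - (elim exE conjE, rule that)
  define b' where "b' = (if a = b then x else b)"
  have b': "b' \<in> K" "a \<noteq> b'" "{a, b} \<subseteq> {a, b'}" "{a, b'} \<inter> {x, y} \<subseteq> {x}"
    using ab xy by (auto simp: b'_def)
  obtain D where D: "D \<in> L" "set D \<inter> K = {a, b'}"
    using pair[of a b'] ab(2) b' by blast
  have D_colours: "m ` (set D - K) \<inter> {a, b'} = {}"
    using colours[OF D b'(2)] by blast
  obtain s t where st: "s \<noteq> t" "{s, t} \<subseteq> set C \<inter> set D"
    using share[OF C(1) D(1)] by blast
  have "u = x" if "u \<in> {s, t}" for u
  proof (cases "u \<in> K")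
    case True
    then have "u \<in> {x, y} \<inter> {a, b'}"
      using that st(2) C(2) D(2) by blast
    then show ?thesis
      using b'(4) by blast
  next
    case False
    then have "m u \<in> {a, b}" "m u \<in> m ` (set D - K)"
      using that st(2) ab(1) by blast+
    then show ?thesis
      using D_colours b'(3) by blast
  qed
  then show False
    using st(1) by blast
qed

text \<open>If every set of \<open>k - 1\<close> vertices misses a cycle of the family, then a cycle whose vertices are,
  up to one, at least as young as \<open>v\<close> leads to such a cycle for a younger vertex, without end.\<close>
lemma ktree_cycles_transversal:
  assumes T: "ktree k V E"
    and cyc: "\<And>C. C \<in> L \<Longrightarrow> is_cycle V E C"
    and share: "\<And>C D. C \<in> L \<Longrightarrow> D \<in> L \<Longrightarrow> \<exists>x y. x \<noteq> y \<and> {x, y} \<subseteq> set C \<inter> set D"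
  shows "\<exists>S\<subseteq>V. card S \<le> k - 1 \<and> (\<forall>C\<in>L. set C \<inter> S \<noteq> {})"
proof (rule ccontr)
  assume "\<not> ?thesis"
  then have miss: "\<exists>C\<in>L. set C \<inter> S = {}" if "S \<subseteq> V" "card S \<le> k - 1" for S
    using that by blast
  obtain r K m where b: "bags k V E r K m"
    using ktree_has_bags[OF T] by blast
  have fin: "finite V"
    using ktree_finite[OF T] .
  define P where "P v \<longleftrightarrow> v \<in> V \<and> 0 < r v \<and>
    (\<exists>C\<in>L. v \<in> set C \<and> (\<exists>q. {u \<in> set C. r u < r v} \<subseteq> {q}))" for v
  \<comment> \<open>A vertex \<open>w\<close> of least rank on \<open>C\<close> outside
    \<open>X\<close> works: anything older on \<open>C\<close> lies in \<open>X\<close>, hence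
    equals \<open>q\<close>.\<close>
  have first: "\<exists>w\<in>set C - X. {u \<in> set C. r u < r w} \<subseteq> {q}"
    if C: "C \<in> L" and X: "set C \<inter> X \<subseteq> {q}" for C X q
  proof -
    obtain x y where "x \<in> set C" "y \<in> set C" "x \<noteq> y"
      using is_cycle_obtain_two[OF cyc[OF C]] .
    then have "\<exists>w. w \<in> set C - X"
      using X by blast
    then obtain w where "w \<in> set C - X" "\<forall>u. u \<in> set C - X \<longrightarrow> r w \<le> r u"
      using ex_has_least_nat[of "\<lambda>w. w \<in> set C - X" _ r] by blast
    then show ?thesis
      using X by (intro bexI[of _ w]) (auto simp: not_le[symmetric])
  qed
  have CV: "set C \<subseteq> V" if "C \<in> L" for C
    using cyc[OF that] by (simp add: is_cycle_def)
  have younger: "\<exists>w. P w \<and> r v < r w" if Pv: "P v" for v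
  proof -
    have v: "v \<in> V" "0 < r v"
      using Pv by (auto simp: P_def)
    have Kv: "v \<in> K v" "K v \<subseteq> V" "card (K v) = Suc k" "\<And>u. u \<in> K v \<Longrightarrow> u \<noteq> v \<Longrightarrow> r u < r v"
      "\<And>u. u \<in> V - K v \<Longrightarrow> m v u \<in> K v \<and> {u, m v u} \<notin> E"
      "\<And>u. u \<in> V - K v \<Longrightarrow> r u \<le> r v \<Longrightarrow> m v u = v"
      "\<And>u w. u \<in> V - K v \<Longrightarrow> w \<in> V - K v \<Longrightarrow> {u, w} \<in> E \<Longrightarrow> m v u = m v w"
      using b v unfolding bags_def by blast+
    have "finite (K v)"
      using Kv(2) fin finite_subset by blast
    then obtain D p where D: "D \<in> L" "set D \<inter> K v \<subseteq> {p}"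
      using cycle_meets_bag_at_most_once[OF cyc share miss _ Kv(2,3,5,7)] by blast
    obtain w where w: "w \<in> set D - K v" "{u \<in> set D. r u < r w} \<subseteq> {p}"
      using first[OF D] by blast
    \<comment> \<open>With colour \<open>v\<close> at \<open>w\<close>, all of \<open>D\<close>
      outside the bag has colour \<open>v\<close>, and \<open>D\<close> avoids \<open>v\<close>. The
      cycle \<open>C\<close> behind \<open>P v\<close> has at most one vertex \<open>q\<close> older
      than \<open>v\<close>; each arc left after deleting \<open>v\<close> and \<open>q\<close>
      contains a neighbour of \<open>v\<close>, so its colour is not \<open>v\<close>. Hence
      \<open>C\<close> and \<open>D\<close> share at most \<open>q\<close>.\<close>
    have "m v w \<noteq> v"
    proof
      assume up: "m v w = v"
      have D_colour: "m v u = v" if u: "u \<in> set D - K v" for u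
      proof (cases "set D \<inter> K v = {}")
        \<comment> \<open>Here \<open>p\<close> may be a vertex of \<open>D\<close> outside the bag,
          so the vertex deleted is \<open>v\<close>, which is not on \<open>D\<close>.\<close>
        case True
        have "v \<notin> set D"
          using True Kv(1) by blast
        moreover have "m v u' = m v w'"
          if "u' \<in> set D - {v}" "w' \<in> set D - {v}" "{u', w'} \<in> E" for u' w'
          using that Kv(7) True CV[OF D(1)] by blast
        ultimately have "m v u = m v w"
          using cycle_minus_vertex_const[OF cyc[OF D(1)], of v "m v" u w] u w(1) by blast
        then show ?thesis
          using up by simp
      next
        case False
        then have eq: "set D - K v = set D - {p}"
          using D(2) by blast
        have "m v u' = m v w'"
          if "u' \<in> set D - {p}" "w' \<in> set D - {p}" "{u', w'} \<in> E" for u' w'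
          using that Kv(7) eq CV[OF D(1)] by blast
        then have "m v u = m v w"
          using cycle_minus_vertex_const[OF cyc[OF D(1)], of p "m v" u w] u w(1) eq by blast
        then show ?thesis
          using up by simp
      qed
      \<comment> \<open>Otherwise \<open>v\<close> is the only bag vertex on \<open>D\<close>, and
        its neighbour on \<open>D\<close> has colour \<open>v\<close> while being adjacent to
        \<open>v\<close>.\<close>
      have vD: "v \<notin> set D"
      proof
        assume "v \<in> set D"
        then obtain y where y: "y \<in> set D" "y \<noteq> v" "{y, v} \<in> E"
          using cycle_has_neighbour[OF cyc[OF D(1)]] by blast
        have "y \<in> set D - K v"
          using y \<open>v \<in> set D\<close> Kv(1) D(2) by blast
        then show False
          using D_colour Kv(5)[of y] CV[OF D(1)] y(3) by auto
      qed
      obtain C q0 where C: "C \<in> L" "v \<in> set C" "{u \<in> set C. r u < r v} \<subseteq> {q0}"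
        using Pv unfolding P_def by blast
      \<comment> \<open>Deleting two vertices requires \<open>q\<close> on \<open>C\<close> and
        different from \<open>v\<close>. If \<open>q0\<close> does not qualify, no vertex of
        \<open>C\<close> is older than \<open>v\<close>, and any other vertex of \<open>C\<close>
        will do.\<close>
      obtain q where q: "q \<in> set C" "q \<noteq> v" "{u \<in> set C. r u < r v} \<subseteq> {q}"
      proof (cases "q0 \<in> set C \<and> q0 \<noteq> v")
        case False
        obtain y where "y \<in> set C" "y \<noteq> v"
          using cycle_has_neighbour[OF cyc[OF C(1)] C(2)] by blast
        moreover have "{u \<in> set C. r u < r v} = {}"
          using C(3) False by auto
        ultimately show ?thesis
          using that[of y] by blast
      qed (use C(3) that in blast)
      have CK: "u \<notin> K v" if "u \<in> set C - {v, q}" for u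
        using that q(3) Kv(4)[of u] by blast
      have C_colour: "m v u \<noteq> v" if u: "u \<in> set C - {v, q}" for u
      proof
        assume "m v u = v"
        have const: "m v u' = m v w'"
          if "u' \<in> set C - {v, q}" "w' \<in> set C - {v, q}" "{u', w'} \<in> E" for u' w'
          using that Kv(7) CK CV[OF C(1)] by blast
        obtain z where z: "z \<in> set C - {v, q}" "{z, v} \<in> E" "m v z = m v u"
          using cycle_minus_two_vertices_colours(2)
              [OF cyc[OF C(1)] C(2) q(1) q(2)[symmetric], where f = "m v", OF const] u
          by blast
        then show False
          using Kv(5)[of z] CK[OF z(1)] CV[OF C(1)] \<open>m v u = v\<close> by auto
      qed
      obtain s t where st: "s \<noteq> t" "{s, t} \<subseteq> set C \<inter> set D"
        using share[OF C(1) D(1)] by blast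
      have "u = q" if "u \<in> {s, t}" for u
      proof (rule ccontr)
        assume "u \<noteq> q"
        then have "u \<in> set C - {v, q}" "u \<in> set D"
          using that st(2) vD by blast+
        then show False
          using C_colour CK D_colour by blast
      qed
      then show False
        using st(1) by blast
    qed
    then have "r v < r w"
      using Kv(6)[of w] w(1) CV[OF D(1)] by (meson DiffD1 DiffD2 DiffI not_le subsetD)
    moreover have "P w"
      unfolding P_def using w D(1) CV[OF D(1)] calculation by auto
    ultimately show ?thesis
      by blast
  qed
  have bounded: "\<forall>v. P v \<longrightarrow> r v < Suc (Max (r ` V))"
    using fin by (simp add: P_def less_Suc_eq_le)
  define A where "A = {v \<in> V. r v = 0}"
  have A: "A \<subseteq> V" "card A = k" "finite A"
    using b fin by (auto simp: A_def bags_def)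
  \<comment> \<open>A cycle that avoids all but one vertex of the initial clique yields the first
    vertex satisfying \<open>P\<close>. If the clique is empty, then \<open>k = 0\<close> and
    \<open>k - 1\<close> truncates to \<open>0\<close>.\<close>
  obtain C a where C: "C \<in> L" "set C \<inter> A \<subseteq> {a}"
  proof (cases "A = {}")
    case True
    then show ?thesis
      using miss[of "{}"] that by auto
  next
    case False
    then obtain a where "a \<in> A"
      by blast
    then have "card (A - {a}) \<le> k - 1"
      using A by simp
    then show ?thesis
      using miss[of "A - {a}"] A(1) that[of _ a] by blast
  qed
  obtain w where "w \<in> set C - A" "{u \<in> set C. r u < r w} \<subseteq> {a}"
    using first[OF C] by blast
  then have "P w"
    using C(1) CV[OF C(1)] by (auto simp: P_def A_def)
  from ex_has_greatest_nat[OF this bounded] obtain v where "P v" "\<forall>u. P u \<longrightarrow> r u \<le> r v"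
    by blast
  then show False
    using younger[of v] by (meson not_le)
qed

section \<open>Transfer from the host \<open>k\<close>-tree to \<open>G\<close>\<close>

theorem theorem6p2:
  fixes V :: "'a set" and E :: "'a set set" and k :: nat
  assumes "partial_ktree k V E"
    and "two_connected V E"
  shows "lct V E \<le> k - 1"
proof -
  obtain V' :: "nat set" and E' f where T: "ktree k V' E'" and f: "inj_on f V" "f ` V \<subseteq> V'"
    and edge: "\<forall>u\<in>V. \<forall>v\<in>V. {u, v} \<in> E \<longrightarrow> {f u, f v} \<in> E'"
    using assms(1) unfolding partial_ktree_def by - (elim conjE exE, rule that)
  define L where "L = {map f c |c. is_longest_cycle V E c}"
  have "is_cycle V' E' C" if C: "C \<in> L" for C
  proof -
    obtain c where c: "C = map f c" "is_cycle V E c"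
      using C by (auto simp: L_def is_longest_cycle_def)
    have V: "set c \<subseteq> V"
      using c(2) by (simp add: is_cycle_def)
    have "{map f c ! i, map f c ! ((i + 1) mod length c)} \<in> E'" if "i < length c" for i
    proof -
      have lt: "(i + 1) mod length c < length c"
        using that by (intro mod_less_divisor) auto
      then have "c ! i \<in> V" "c ! ((i + 1) mod length c) \<in> V"
        using subsetD[OF V nth_mem] that by blast+
      moreover have "{c ! i, c ! ((i + 1) mod length c)} \<in> E"
        using c(2) that by (simp add: is_cycle_def)
      ultimately show ?thesis
        using edge that lt by simp
    qed
    moreover have "distinct (map f c)"
      using c(2) inj_on_subset[OF f(1) V] by (simp add: is_cycle_def distinct_map)
    ultimately show ?thesis
      using c V f(2) by (auto simp: is_cycle_def)
  qed
  moreover have "\<exists>x y. x \<noteq> y \<and> {x, y} \<subseteq> set C \<inter> set D" if CD: "C \<in> L" "D \<in> L" for C D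
  proof -
    obtain c d where c: "C = map f c" "is_longest_cycle V E c"
      and d: "D = map f d" "is_longest_cycle V E d"
      using CD by (auto simp: L_def)
    obtain x y where xy: "x \<noteq> y" "{x, y} \<subseteq> set c \<inter> set d"
      using longest_cycles_share_two[OF assms(2) c(2) d(2)] by blast
    have "set c \<subseteq> V"
      using c(2) by (simp add: is_longest_cycle_def is_cycle_def)
    then have "f x \<noteq> f y"
      using xy f(1) by (auto simp: inj_on_def)
    then show ?thesis
      using xy(2) c(1) d(1) by (intro exI[of _ "f x"] exI[of _ "f y"]) auto
  qed
  ultimately obtain S' where S': "S' \<subseteq> V'" "card S' \<le> k - 1" "\<forall>C\<in>L. set C \<inter> S' \<noteq> {}"
    using ktree_cycles_transversal[OF T, of L] by blast
  \<comment> \<open>Vertices of \<open>S'\<close> outside the image of \<open>f\<close> are dropped;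
    injectivity keeps the preimage no larger than \<open>S'\<close>.\<close>
  define S where "S = {v \<in> V. f v \<in> S'}"
  have "finite S'"
    using S'(1) ktree_finite[OF T] finite_subset by blast
  moreover have "inj_on f S" "f ` S \<subseteq> S'"
    using f(1) by (auto simp: S_def inj_on_def)
  ultimately have "card S \<le> k - 1"
    using card_inj_on_le[of f S S'] S'(2) by simp
  moreover have "set c \<inter> S \<noteq> {}" if "is_longest_cycle V E c" for c
  proof -
    have "map f c \<in> L" "set c \<subseteq> V"
      using that by (auto simp: L_def is_longest_cycle_def is_cycle_def)
    then show ?thesis
      using S'(3) by (fastforce simp: S_def)
  qed
  then have "lct V E \<le> card S"
    unfolding lct_def by (intro Least_le exI[of _ S]) (auto simp: S_def)
  ultimately show ?thesis
    by simp
qed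

end
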